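(* Let $\mathbb{F}$ be an infinite field of arbitrary characteristic and let $d\geq 1$. The set $$S(d)=\{\mathrm{tr}(X_i),\ \det(X_i)\ (1\leq i\leq d)\}\cup\{\mathrm{tr}(X_iX_j)\ (1\leq i<j\leq d)\}\cup\{\mathrm{tr}(X_iX_jX_k)\ (1\leq i<j<k\leq d)\}$$ is a separating set for the algebra of matrix invariants $R^{GL(2)}$, and it is minimal with respect to inclusion: no proper subset of $S(d)$ is separating.
   Context: Let $R=R_{2,d}=\mathbb{F}[x_{ij}(k)\mid 1\leq i,j\leq 2,\ 1\leq k\leq d]$ and let $X_k=(x_{ij}(k))_{1\le i,j\le 2}$ be the $2\times 2$ generic matrices. The group $GL(2)$ acts on $R$ by $g\cdot x_{ij}(k)=(g^{-1}X_kg)_{ij}$, and $R^{GL(2)}$ is the subalgebra of invariants. Let $H=M(2)^{\oplus d}$ be the space of $d$-tuples of $2\times 2$ matrices over $\mathbb{F}$; an element $f\in R$ is viewed as a polynomial function on $H$ via $x_{ij}(k)(A_1,\dots,A_d)=(A_k)_{ij}$. Two points $u,v\in H$ are separated by a subset $S\subseteq R^{GL(2)}$ if some $f\in S$ satisfies $f(u)\neq f(v)$; they are separated if they are separated by $R^{GL(2)}$. A subset $S\subseteq R^{GL(2)}$ is separating if any $u,v\in H$ that are separated are separated by $S$. *)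

theory Defs
  imports "HOL-Analysis.Analysis"
begin

text \<open>A point of H = M(2)^d: a d-tuple (A_1,...,A_d) of 2x2 matrices, encoded as a
  map from indices to matrices which vanishes outside {1..d}.\<close>
type_synonym 'a tup = "nat \<Rightarrow> 'a^2^2"

definition H :: "nat \<Rightarrow> ('a::field) tup set" where
  "H d = {u. \<forall>k. k \<notin> {1..d} \<longrightarrow> u k = 0}"

text \<open>The polynomial functions on H, i.e. the image of R = F[x_ij(k)] in functions on H:
  generated by constants and the coordinate functions x_ij(k) under + and *.\<close>
inductive_set poly_fun :: "nat \<Rightarrow> (('a::field) tup \<Rightarrow> 'a) set" for d :: nat where
  const: "(\<lambda>u. c) \<in> poly_fun d"
| coord: "k \<in> {1..d} \<Longrightarrow> (\<lambda>u. u k $ i $ j) \<in> poly_fun d"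
| add: "f \<in> poly_fun d \<Longrightarrow> g \<in> poly_fun d \<Longrightarrow> (\<lambda>u. f u + g u) \<in> poly_fun d"
| mult: "f \<in> poly_fun d \<Longrightarrow> g \<in> poly_fun d \<Longrightarrow> (\<lambda>u. f u * g u) \<in> poly_fun d"

definition invariants :: "nat \<Rightarrow> (('a::field) tup \<Rightarrow> 'a) set" where
  "invariants d = {f \<in> poly_fun d. \<forall>g::'a^2^2. invertible g \<longrightarrow>
      (\<forall>u \<in> H d. f (\<lambda>k. matrix_inv g ** u k ** g) = f u)}"

definition separated_by :: "nat \<Rightarrow> (('a::field) tup \<Rightarrow> 'a) set \<Rightarrow> 'a tup \<Rightarrow> 'a tup \<Rightarrow> bool" where
  "separated_by d S u v \<longleftrightarrow> (\<exists>f \<in> S. f u \<noteq> f v)"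

definition separating :: "nat \<Rightarrow> (('a::field) tup \<Rightarrow> 'a) set \<Rightarrow> bool" where
  "separating d S \<longleftrightarrow> S \<subseteq> invariants d \<and>
     (\<forall>u \<in> H d. \<forall>v \<in> H d. separated_by d (invariants d) u v \<longrightarrow> separated_by d S u v)"

definition S :: "nat \<Rightarrow> (('a::field) tup \<Rightarrow> 'a) set" where
  "S d = {(\<lambda>u. trace (u i)) | i. i \<in> {1..d}}
       \<union> {(\<lambda>u. det (u i)) | i. i \<in> {1..d}}
       \<union> {(\<lambda>u. trace (u i ** u j)) | i j. 1 \<le> i \<and> i < j \<and> j \<le> d}
       \<union> {(\<lambda>u. trace (u i ** u j ** u k)) | i j k. 1 \<le> i \<and> i < j \<and> j < k \<and> k \<le> d}"

end

theory Submission
  imports Defs "HOL-Computational_Algebra.Polynomial"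
begin

text \<open>Let u and v agree on S. Then the traces of all words of length at most 3 agree, since
  Cayley-Hamilton reduces repetitions and transpositions of letters to shorter words. The form
  tr(ABC) - tr(ACB) is, up to sign, the determinant of the coordinates of (1, A, B, C).
  If it is nonzero for some triple (u_i, u_j, u_k) or (u_i, u_j, u_i u_j), then 1, A, B, C is a basis of M(2)
  whose structure constants are determined by the common trace data, so the corresponding map for v is an
  algebra automorphism, hence inner, and it takes every u_k to v_k.
  Otherwise every commutator Z = [u_i, u_j] is nilpotent and orthogonal to all u_k, so that a nonzero Z
  yields a common eigenvector over the base field. If all the u_k commute and have no common eigenvector, then
  they lie in a quadratic extension F[u_i], and its norm form is anisotropic, which
  determines them from their traces and determinants after conjugating u_i to v_i. Tuples with a common
  eigenvector degenerate to diagonal tuples, because a polynomial in t that is constant for t nonzero is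
  constant on an infinite field. No field extension is used.

  For minimality, each element of S separates two explicit tuples on which all the others agree; for
  tr(X_i X_j X_k) these are (E12, E21, E11) and its transpose.\<close>

section \<open>Traces of words\<close>

lemma matrix_mult_nth_2: "((A::'a::field^2^2) ** B) $ i $ j = A$i$1 * B$1$j + A$i$2 * B$2$j"
  by (simp add: matrix_matrix_mult_def sum_2)

lemma trace_2: "trace (A::'a::field^2^2) = A$1$1 + A$2$2"
  by (simp add: trace_def sum_2)

lemma matrix_eq_2:
  "(A::'a^2^2) = B \<longleftrightarrow> A$1$1 = B$1$1 \<and> A$1$2 = B$1$2 \<and> A$2$1 = B$2$1 \<and> A$2$2 = B$2$2"
  by (auto simp: vec_eq_iff forall_2)

lemmas matrix_2 = matrix_mult_nth_2 trace_2 det_2 matrix_eq_2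

lemma trace_square_2: "trace (A ** A) = trace A ^ 2 - 2 * det (A::'a::field^2^2)"
  unfolding matrix_2 by algebra

lemma trace_square_mult_2:
  "trace (A ** A ** B) = trace A * trace (A ** B) - det A * trace (B::'a::field^2^2)"
  unfolding matrix_2 by algebra

lemma trace_mult_cyclic_2: "trace (A ** B ** C) = trace (B ** C ** A)" for A B C :: "'a::field^2^2"
  unfolding matrix_2 by algebra

text \<open>The polarised Cayley-Hamilton identity, multiplied by a third matrix and traced; it
  holds in every characteristic.\<close>

lemma trace_mult_swap_2:
  "trace (A ** C ** B) = trace A * trace (B ** C) + trace B * trace (A ** C) + trace C * trace (A ** B)
     - trace A * trace B * trace C - trace (A ** B ** (C::'a::field^2^2))"
  unfolding matrix_2 by algebra

lemma trace_mult_commute_2: "trace (A ** B) = trace (B ** (A::'a::field^2^2))"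
  unfolding matrix_2 by algebra

text \<open>The index triples are unordered, so traces of words up to length 3 can be quoted
  directly. \<open>I\<close> is \<open>{1..d}\<close> for points of \<open>H d\<close> and
  \<open>{..<4}\<close> for a basis of M(2).\<close>

definition agree :: "nat set \<Rightarrow> 'a::field tup \<Rightarrow> 'a tup \<Rightarrow> bool" where
  "agree I u v \<longleftrightarrow> (\<forall>i\<in>I. trace (u i) = trace (v i) \<and> det (u i) = det (v i)) \<and>
     (\<forall>i\<in>I. \<forall>j\<in>I. trace (u i ** u j) = trace (v i ** v j)) \<and>
     (\<forall>i\<in>I. \<forall>j\<in>I. \<forall>k\<in>I. trace (u i ** u j ** u k) = trace (v i ** v j ** v k))"

text \<open>A triple of distinct indices is rotated until its least index comes first; then
  \<open>trace_mult_swap_2\<close> swaps the other two if necessary.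
  \<open>trace_square_mult_2\<close> deals with repeated letters.\<close>

lemma agreeI:
  assumes 1: "\<And>i. i \<in> I \<Longrightarrow> trace (u i) = trace (v i)"
    and d: "\<And>i. i \<in> I \<Longrightarrow> det (u i) = det (v i)"
    and lt2: "\<And>i j. i \<in> I \<Longrightarrow> j \<in> I \<Longrightarrow> i < j \<Longrightarrow> trace (u i ** u j) = trace (v i ** v j)"
    and lt3: "\<And>i j k. i \<in> I \<Longrightarrow> j \<in> I \<Longrightarrow> k \<in> I \<Longrightarrow> i < j \<Longrightarrow> j < k \<Longrightarrow>
      trace (u i ** u j ** u k) = trace (v i ** v j ** v k)"
  shows "agree I u v"
proof -
  have 2: "trace (u i ** u j) = trace (v i ** v j)" if "i \<in> I" "j \<in> I" for i j
  proof (cases i j rule: linorder_cases)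
    case less then show ?thesis using lt2 that by blast
  next
    case equal then show ?thesis using 1 d that by (simp add: trace_square_2)
  next
    case greater then show ?thesis using lt2 that by (metis trace_mult_commute_2)
  qed
  define P where "P i j k \<longleftrightarrow> trace (u i ** u j ** u k) = trace (v i ** v j ** v k)" for i j k
  have cyc: "P j k i" if "P i j k" for i j k
    using that unfolding P_def by (metis trace_mult_cyclic_2)
  have swap: "P i k j" if "P i j k" "i \<in> I" "j \<in> I" "k \<in> I" for i j k
    using that 1 2 unfolding P_def trace_mult_swap_2[of _ "u k" "u j"] trace_mult_swap_2[of _ "v k" "v j"]
    by simp
  have rep: "P i i k" if "i \<in> I" "k \<in> I" for i k
    using that 1 2 d unfolding P_def by (simp add: trace_square_mult_2)
  have lt: "P i j k" if "i \<in> I" "j \<in> I" "k \<in> I" "i < j" "j < k" for i j k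
    using lt3 that unfolding P_def by blast
  have lt': "P i j k" if I: "i \<in> I" "j \<in> I" "k \<in> I" and "i < j" "i < k" for i j k
    using that lt[of i j k] lt[of i k j] swap[of i k j] rep[of j i] cyc[of j j i] cyc[of j i j]
    by (cases j k rule: linorder_cases) auto
  have "P i j k" if I: "i \<in> I" "j \<in> I" "k \<in> I" for i j k
  proof -
    consider "i = j" | "j = k" | "i = k" | "i < j" "i < k" | "j < k" "j < i" | "k < i" "k < j"
      by linarith
    then show ?thesis
    proof cases
      case 1 then show ?thesis using rep I by blast
    next
      case 2 then show ?thesis using rep I cyc by blast
    next
      case 3 then show ?thesis using rep I cyc by blast
    next
      case 4 then show ?thesis using lt' I by blast
    next
      case 5 then show ?thesis using lt'[of j k i] I cyc by blast
    next
      case 6 then show ?thesis using lt'[of k i j] I cyc by blast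
    qed
  qed
  then show ?thesis using 1 2 d unfolding agree_def P_def by blast
qed

section \<open>Conjugacy of tuples generating the full matrix algebra\<close>

definition lincomb :: "(nat \<Rightarrow> 'a::field^2^2) \<Rightarrow> (nat \<Rightarrow> 'a) \<Rightarrow> 'a^2^2" where
  "lincomb e c = (\<chi> i j. \<Sum>p<4. c p * e p $ i $ j)"

lemma trace_lincomb_mult: "trace (lincomb e c ** M) = (\<Sum>p<4. c p * trace (e p ** M))"
  by (simp add: lincomb_def matrix_2 eval_nat_numeral algebra_simps)

lemma trace_lincomb_mult2: "trace (M ** lincomb e c ** N) = (\<Sum>p<4. c p * trace (M ** e p ** N))"
  for M N :: "'a::field^2^2"
  by (simp add: lincomb_def matrix_2 eval_nat_numeral algebra_simps)

definition triple_form :: "'a::field^2^2 \<Rightarrow> 'a^2^2 \<Rightarrow> 'a^2^2 \<Rightarrow> 'a" where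
  "triple_form A B C = trace (A ** B ** C) - trace (A ** C ** B)"

text \<open>Cramer's rule: the four trace conditions are a linear system in the entries of
  \<open>X - Y\<close>, with determinant \<open>triple_form A B C\<close> up to sign.\<close>

lemma trace_form_nondegenerate:
  assumes T: "triple_form A B C \<noteq> 0"
    and "trace X = trace Y" "trace (X ** A) = trace (Y ** A)" "trace (X ** B) = trace (Y ** B)"
      "trace (X ** C) = trace (Y ** C)"
  shows "X = Y"
proof -
  define Z where "Z = X - Y"
  have Z: "trace Z = 0" "trace (Z ** A) = 0" "trace (Z ** B) = 0" "trace (Z ** C) = 0"
    using assms by (simp_all add: Z_def matrix_2 algebra_simps)
  have "triple_form A B C * Z$1$1 = 0" "triple_form A B C * Z$1$2 = 0" "triple_form A B C * Z$2$1 = 0"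
     "triple_form A B C * Z$2$2 = 0"
    using Z unfolding triple_form_def matrix_2 by algebra+
  with T have "Z = 0" by (simp add: matrix_eq_2)
  then show ?thesis by (simp add: Z_def)
qed

lemma lincomb_exists:
  fixes e :: "nat \<Rightarrow> 'a::field^2^2"
  assumes T: "triple_form (e 1) (e 2) (e 3) \<noteq> 0" and e0: "e 0 = mat 1"
  shows "\<exists>c. X = lincomb e c"
proof -
  define A B C where "A = e 1" and "B = e 2" and "C = e 3"
  define t where "t = triple_form A B C"
  have t: "t \<noteq> 0" using T by (simp add: t_def A_def B_def C_def)
  define D where "D P Q = trace (X ** (P ** Q - Q ** P))" for P Q :: "'a^2^2"
  define c0 where "c0 = t * X$1$1 - A$1$1 * D B C - B$1$1 * D C A - C$1$1 * D A B"
  define c where "c p = (if p = 0 then c0 else if p = 1 then D B C else if p = 2 then D C A else D A B) / t" for p :: nat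
  have "X$1$1 * t = c0 + D B C * A$1$1 + D C A * B$1$1 + D A B * C$1$1"
       "X$1$2 * t = D B C * A$1$2 + D C A * B$1$2 + D A B * C$1$2"
       "X$2$1 * t = D B C * A$2$1 + D C A * B$2$1 + D A B * C$2$1"
       "X$2$2 * t = c0 + D B C * A$2$2 + D C A * B$2$2 + D A B * C$2$2"
    unfolding c0_def t_def D_def triple_form_def by (simp_all add: matrix_2) algebra+
  then have "X = lincomb e c"
    using t e0 unfolding lincomb_def matrix_eq_2
    by (simp add: eval_nat_numeral c_def mat_def A_def B_def C_def field_simps)
  then show ?thesis by blast
qed

text \<open>Carrying coordinates from the basis \<open>e\<close> to the basis \<open>e'\<close> is
  multiplicative, as both have the same structure constants. The proof makes this automorphism of
  M(2) inner by an explicit \<open>g\<close>, in the manner of Skolem-Noether.\<close>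

lemma conj_of_agree:
  fixes e e' :: "nat \<Rightarrow> 'a::field^2^2"
  assumes T: "triple_form (e 1) (e 2) (e 3) \<noteq> 0" and e0: "e 0 = mat 1" "e' 0 = mat 1"
    and ag: "agree {..<4} e e'"
  obtains g where "det g \<noteq> 0"
    "\<And>X Y. (\<And>p. p < 4 \<Longrightarrow> trace (X ** e p) = trace (Y ** e' p)) \<Longrightarrow> Y ** g = g ** X"
proof -
  have ag2: "trace (e p ** e q) = trace (e' p ** e' q)" if "p < 4" "q < 4" for p q
    using ag that unfolding agree_def by auto
  have ag3: "trace (e p ** e q ** e r) = trace (e' p ** e' q ** e' r)" if "p < 4" "q < 4" "r < 4" for p q r
    using ag that unfolding agree_def by auto
  have T': "triple_form (e' 1) (e' 2) (e' 3) \<noteq> 0"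
    using T ag3[of 1 2 3] ag3[of 1 3 2] by (simp add: triple_form_def)
  have nondeg: "X = Y" if "\<And>p. p < 4 \<Longrightarrow> trace (X ** e' p) = trace (Y ** e' p)" for X Y
    using trace_form_nondegenerate[OF T', of X Y] that[of 0] that[of 1] that[of 2] that[of 3] e0 by simp
  obtain c where c: "\<And>X. X = lincomb e (c X)"
    using lincomb_exists[OF T e0(1)] by metis
  \<comment> \<open>Only the traces of \<open>\<phi> X\<close> against \<open>e'\<close> are
    computed; \<open>nondeg\<close> turns them into matrix identities.\<close>
  define \<phi> where "\<phi> X = lincomb e' (c X)" for X
  have tr: "trace (\<phi> X ** e' q) = trace (X ** e q)" if "q < 4" for X q
    unfolding \<phi>_def by (subst (2) c[of X]) (simp add: trace_lincomb_mult ag2 that)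
  have trm: "trace (\<phi> X ** \<phi> Y ** e' r) = trace (X ** Y ** e r)" if "r < 4" for X Y r
  proof -
    have "trace (\<phi> X ** \<phi> Y ** e' r) = (\<Sum>q<4. c Y q * trace (\<phi> X ** e' q ** e' r))"
      by (subst (2) \<phi>_def) (rule trace_lincomb_mult2)
    also have "\<dots> = (\<Sum>q<4. c Y q * (\<Sum>p<4. c X p * trace (e' p ** e' q ** e' r)))"
      unfolding \<phi>_def matrix_mul_assoc[symmetric] trace_lincomb_mult ..
    also have "\<dots> = (\<Sum>q<4. c Y q * (\<Sum>p<4. c X p * trace (e p ** e q ** e r)))"
      using ag3 that by simp
    also have "\<dots> = (\<Sum>q<4. c Y q * trace (lincomb e (c X) ** e q ** e r))"
      unfolding matrix_mul_assoc[symmetric] trace_lincomb_mult ..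
    also have "\<dots> = trace (X ** lincomb e (c Y) ** e r)"
      unfolding trace_lincomb_mult2 unfolding c[symmetric] ..
    also have "\<dots> = trace (X ** Y ** e r)"
      by (simp only: c[symmetric])
    finally show ?thesis .
  qed
  define unit :: "2 \<Rightarrow> 2 \<Rightarrow> 'a^2^2" where "unit i j = (\<chi> a b. if a = i \<and> b = j then 1 else 0)" for i j
  \<comment> \<open>The matrix units of the first column span a left ideal of M(2) isomorphic to the
    natural module. \<open>F\<close> and \<open>K\<close> are the images of its basis.\<close>
  define F K L where "F = \<phi> (unit 1 1)" and "K = \<phi> (unit 2 1)" and "L = \<phi> (unit 1 2)"
  define comb where "comb x y = (\<chi> i j. x * F$i$j + y * K$i$j)" for x y
  have trc: "trace (comb x y ** M) = x * trace (F ** M) + y * trace (K ** M)" for x y M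
    by (simp add: comb_def matrix_2 algebra_simps)
  have col1: "\<phi> X ** F = comb (X$1$1) (X$2$1)" for X
  proof (rule nondeg)
    fix p :: nat assume p: "p < 4"
    show "trace (\<phi> X ** F ** e' p) = trace (comb (X$1$1) (X$2$1) ** e' p)"
      unfolding trc unfolding F_def K_def trm[OF p] tr[OF p]
      by (simp add: unit_def matrix_2 algebra_simps)
  qed
  have col2: "\<phi> X ** K = comb (X$1$2) (X$2$2)" for X
  proof (rule nondeg)
    fix p :: nat assume p: "p < 4"
    show "trace (\<phi> X ** K ** e' p) = trace (comb (X$1$2) (X$2$2) ** e' p)"
      unfolding trc unfolding F_def K_def trm[OF p] tr[OF p]
      by (simp add: unit_def matrix_2 algebra_simps)
  qed
  have "trace F = 1" using tr[of 0 "unit 1 1"] e0 by (simp add: F_def unit_def trace_2)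
  then have "F \<noteq> 0" by (auto simp: trace_2)
  then obtain j where j: "F$1$j \<noteq> 0 \<or> F$2$j \<noteq> 0"
    by (auto simp: matrix_eq_2)
  \<comment> \<open>The j-th columns of \<open>F\<close> and \<open>K\<close> are the images of the
    standard basis vectors under the intertwiner.\<close>
  define g :: "'a^2^2" where "g = (\<chi> a b. if b = 1 then F$a$j else K$a$j)"
  \<comment> \<open>\<open>L\<close> kills the j-th column of \<open>F\<close> and sends that of
    \<open>K\<close> to that of \<open>F\<close>. If the two were dependent, the column of
    \<open>F\<close> would vanish, against the choice of \<open>j\<close>.\<close>
  have L: "L ** F = comb 0 0" "L ** K = comb 1 0"
    unfolding L_def col1 col2 by (simp_all add: unit_def)
  have "F$1$j * K$2$j - F$2$j * K$1$j \<noteq> 0"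
  proof
    assume *: "F$1$j * K$2$j - F$2$j * K$1$j = 0"
    have **: "L$1$1 * F$1$j + L$1$2 * F$2$j = 0" "L$2$1 * F$1$j + L$2$2 * F$2$j = 0"
      "L$1$1 * K$1$j + L$1$2 * K$2$j = F$1$j" "L$2$1 * K$1$j + L$2$2 * K$2$j = F$2$j"
      using L unfolding vec_eq_iff by (simp_all add: comb_def matrix_2)
    have "F$1$j * F$1$j = 0" "F$2$j * F$2$j = 0"
      using * ** by algebra+
    with j show False by simp
  qed
  then have det: "det g \<noteq> 0" by (simp add: det_2 g_def algebra_simps)
  have int: "\<phi> X ** g = g ** X" for X
  proof -
    have "(\<phi> X ** F) $ a $ j = comb (X$1$1) (X$2$1) $ a $ j"
      "(\<phi> X ** K) $ a $ j = comb (X$1$2) (X$2$2) $ a $ j" for a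
      using col1 col2 by simp_all
    then show ?thesis
      by (simp add: matrix_2 g_def comb_def algebra_simps)
  qed
  have "Y ** g = g ** X" if "\<And>p. p < 4 \<Longrightarrow> trace (X ** e p) = trace (Y ** e' p)" for X Y
    using int[of X] nondeg[of "\<phi> X" Y] that tr by simp
  with det show ?thesis using that by blast
qed

section \<open>Common eigenvectors\<close>

text \<open>The determinant of the pair (z, M z) for z = (x, y), which vanishes iff z is an eigenvector of M or zero.\<close>
definition eigform :: "'a::field^2^2 \<Rightarrow> 'a \<Rightarrow> 'a \<Rightarrow> 'a" where
  "eigform M x y = M$2$1 * x^2 + (M$2$2 - M$1$1) * x * y - M$1$2 * y^2"

definition common_eigenvector :: "nat set \<Rightarrow> 'a::field tup \<Rightarrow> bool" where
  "common_eigenvector I u \<longleftrightarrow> (\<exists>x y. (x \<noteq> 0 \<or> y \<noteq> 0) \<and> (\<forall>k\<in>I. eigform (u k) x y = 0))"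

text \<open>Having an eigenvector over the base field depends only on trace and determinant, so it
  passes between agreeing matrices.\<close>

lemma eigform_zero_iff_root:
  "(\<exists>x y. (x \<noteq> 0 \<or> y \<noteq> 0) \<and> eigform M x y = 0) \<longleftrightarrow> (\<exists>c. c^2 - trace M * c + det M = 0)"
proof
  assume "\<exists>x y. (x \<noteq> 0 \<or> y \<noteq> 0) \<and> eigform M x y = 0"
  then obtain x y where *: "x \<noteq> 0 \<or> y \<noteq> 0" "eigform M x y = 0" by blast
  show "\<exists>c. c^2 - trace M * c + det M = 0"
  proof (cases "x = 0")
    case False
    define z where "z = y / x"
    have "y = z * x" using False by (simp add: z_def)
    then have "x^2 * (M$2$1 + (M$2$2 - M$1$1) * z - M$1$2 * z^2) = 0"
      using *(2) unfolding eigform_def by algebra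
    then have z: "M$2$1 + (M$2$2 - M$1$1) * z - M$1$2 * z^2 = 0" using False by simp
    have "(M$1$1 + M$1$2 * z)^2 - trace M * (M$1$1 + M$1$2 * z) + det M = 0"
      using z unfolding matrix_2 by algebra
    then show ?thesis by blast
  next
    case True
    then have "M$1$2 = 0" using * by (simp add: eigform_def)
    then have "(M$2$2)^2 - trace M * M$2$2 + det M = 0"
      unfolding matrix_2 by algebra
    then show ?thesis by blast
  qed
next
  assume "\<exists>c. c^2 - trace M * c + det M = 0"
  then obtain c where c: "c^2 - trace M * c + det M = 0" by blast
  \<comment> \<open>These vectors are the columns of M - (tr M - c), which M - c kills by
    Cayley-Hamilton. If the second one is zero, then (1, 0) is an eigenvector.\<close>
  have "eigform M (M$1$2) (c - M$1$1) = 0" "eigform M (c - M$2$2) (M$2$1) = 0"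
    using c unfolding eigform_def matrix_2 by algebra+
  moreover have "eigform M 1 0 = 0" if "M$2$1 = 0"
    using that by (simp add: eigform_def)
  ultimately show "\<exists>x y. (x \<noteq> 0 \<or> y \<noteq> 0) \<and> eigform M x y = 0"
    by (metis one_neq_zero)
qed

text \<open>The forms in the hypotheses are -det Z and tr(Z u_k) for the commutator Z of
  \<open>A\<close> and \<open>B\<close>. A nonzero nilpotent Z has rank one with its image equal to
  its kernel, and tr(Z u_k) = 0 says that u_k preserves this line.\<close>

lemma common_eigenvector_of_noncommuting:
  fixes A B :: "'a::field^2^2"
  assumes ne: "A ** B \<noteq> B ** A"
    and T: "triple_form A B (A ** B) = 0" and Tu: "\<And>k. k \<in> I \<Longrightarrow> triple_form A B (u k) = 0"
  shows "common_eigenvector I u"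
proof -
  define Z where "Z = A ** B - B ** A"
  have Z0: "Z \<noteq> 0" using ne by (simp add: Z_def)
  have tr: "Z$1$1 + Z$2$2 = 0" unfolding Z_def by (simp add: matrix_2)
  have "Z$1$1 * Z$2$2 - Z$1$2 * Z$2$1 = 0"
    using T unfolding Z_def triple_form_def by (simp add: matrix_2) algebra
  then have det: "Z$1$1^2 + Z$1$2 * Z$2$1 = 0" using tr by algebra
  have k: "Z$1$1 * u k$1$1 + Z$1$2 * u k$2$1 + Z$2$1 * u k$1$2 + Z$2$2 * u k$2$2 = 0" if "k \<in> I" for k
    using Tu[OF that] unfolding Z_def triple_form_def by (simp add: matrix_2) algebra
  show ?thesis
  proof (cases "Z$2$1 = 0")
    case True
    then have "Z$1$1 = 0" "Z$2$2 = 0" using det tr by auto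
    moreover from this have "Z$1$2 \<noteq> 0" using Z0 True by (auto simp: matrix_eq_2)
    ultimately have "eigform (u k) 1 0 = 0" if "k \<in> I" for k
      using k[OF that] True by (simp add: eigform_def)
    then show ?thesis unfolding common_eigenvector_def by (intro exI[of _ 1] exI[of _ 0]) auto
  next
    case False
    have "eigform (u k) (Z$1$1) (Z$2$1) = 0" if "k \<in> I" for k
      using k[OF that] det tr unfolding eigform_def by algebra
    with False show ?thesis unfolding common_eigenvector_def by blast
  qed
qed

section \<open>Commuting tuples\<close>

text \<open>Commuting matrices are linearly dependent modulo scalars; these are the minors of their
  coordinates there, which are also the coefficients of \<open>eigform\<close>.\<close>

lemma commuting_proportional:
  assumes "A ** B = B ** (A::'a::field^2^2)"
  shows "A$1$2 * B$2$1 = A$2$1 * B$1$2" "A$1$2 * (B$1$1 - B$2$2) = (A$1$1 - A$2$2) * B$1$2"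
    "A$2$1 * (B$1$1 - B$2$2) = (A$1$1 - A$2$2) * B$2$1"
  using assms unfolding matrix_2 by algebra+

text \<open>Modulo scalars, every member of the tuple is a multiple of any nonscalar one, so an
  eigenvector of that one would be common to all.\<close>

lemma common_eigenvector_of_commuting:
  assumes comm: "\<And>i j. i \<in> I \<Longrightarrow> j \<in> I \<Longrightarrow> u i ** u j = u j ** u i"
    and nev: "\<not> common_eigenvector I u"
  obtains i where "i \<in> I" "\<And>x y. eigform (u i) x y = 0 \<Longrightarrow> x = 0 \<and> y = 0"
proof -
  \<comment> \<open>All three values vanish exactly when the matrix is scalar.\<close>
  have "\<exists>i\<in>I. eigform (u i) 1 0 \<noteq> 0 \<or> eigform (u i) 0 1 \<noteq> 0 \<or> eigform (u i) 1 1 \<noteq> 0"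
  proof (rule ccontr)
    assume "\<not> ?thesis"
    then have "common_eigenvector I u" unfolding common_eigenvector_def by (intro exI[of _ 1] exI[of _ 0]) auto
    with nev show False by blast
  qed
  then obtain i where i: "i \<in> I" "u i$1$2 \<noteq> 0 \<or> u i$2$1 \<noteq> 0 \<or> u i$1$1 - u i$2$2 \<noteq> 0"
    by (auto simp: eigform_def)
  have "x = 0 \<and> y = 0" if e: "eigform (u i) x y = 0" for x y
  proof (rule ccontr)
    assume xy: "\<not> ?thesis"
    have "eigform (u k) x y = 0" if "k \<in> I" for k
    proof -
      note p = commuting_proportional[OF comm[OF i(1) that]]
      have "u i$1$2 * eigform (u k) x y = 0" "u i$2$1 * eigform (u k) x y = 0"
        "(u i$1$1 - u i$2$2) * eigform (u k) x y = 0"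
        using e p unfolding eigform_def by algebra+
      then show ?thesis using i(2) by auto
    qed
    with xy nev show False unfolding common_eigenvector_def by blast
  qed
  with i show ?thesis using that by blast
qed

lemma conj_of_commuting:
  fixes u v :: "'a::field tup"
  assumes ag: "agree I u v" and i: "i \<in> I"
    and comm: "\<And>j. j \<in> I \<Longrightarrow> u i ** u j = u j ** u i" "\<And>j. j \<in> I \<Longrightarrow> v i ** v j = v j ** v i"
    and aniso: "\<And>x y. eigform (u i) x y = 0 \<Longrightarrow> x = 0 \<and> y = 0"
  obtains g where "det g \<noteq> 0" "\<And>k. k \<in> I \<Longrightarrow> u k ** g = g ** v k"
proof -
  define M N where "M = u i" and "N = v i"
  have tr: "trace M = trace N" and det: "det M = det N"
    using ag i unfolding agree_def M_def N_def by blast+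
  have noroot: "c^2 - trace M * c + det M \<noteq> 0" for c
    using eigform_zero_iff_root[of M] aniso unfolding M_def by metis
  have M21: "M$2$1 \<noteq> 0"
    using aniso[of 1 0] by (auto simp: eigform_def M_def)
  have N21: "N$2$1 \<noteq> 0"
  proof
    assume "N$2$1 = 0"
    then have "eigform N 1 0 = 0" by (simp add: eigform_def)
    then show False using eigform_zero_iff_root[of N] noroot tr det zero_neq_one by metis
  qed
  \<comment> \<open>The left-hand side of the hypothesis is the determinant of x + y M.\<close>
  have norm: "x = 0 \<and> y = 0" if n: "x^2 + trace M * x * y + det M * y^2 = 0" for x y
  proof (cases "y = 0")
    case True then show ?thesis using n by simp
  next
    case False
    define z where "z = x / y"
    have "x = z * y" using False by (simp add: z_def)
    then have "y^2 * ((-z)^2 - trace M * (-z) + det M) = 0" using n by algebra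
    then show ?thesis using False noroot[of "- z"] by simp
  qed
  \<comment> \<open>Up to the factor N$2$1, this maps the basis (e1, N e1) to (e1, M e1).\<close>
  define g :: "'a^2^2" where
    "g = vector [vector [N$2$1, M$1$1 - N$1$1], vector [0, M$2$1]]"
  have g: "g$1$1 = N$2$1" "g$1$2 = M$1$1 - N$1$1" "g$2$1 = 0" "g$2$2 = M$2$1"
    by (simp_all add: g_def)
  have Mg: "M ** g = g ** N"
    using tr det unfolding matrix_2 g by algebra
  have "u k ** g = g ** v k" if k: "k \<in> I" for k
  proof -
    \<comment> \<open>Coordinates in the basis (1, M) of the quadratic extension F[M], read off the
      first column.\<close>
    define b a where "b = u k$2$1 / M$2$1" and "a = u k$1$1 - b * M$1$1"
    define b' a' where "b' = v k$2$1 / N$2$1" and "a' = v k$1$1 - b' * N$1$1"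
    note pu = commuting_proportional[OF comm(1)[OF k], folded M_def]
    note pv = commuting_proportional[OF comm(2)[OF k], folded N_def]
    have u1: "u k$2$1 = b * M$2$1" "u k$1$1 = a + b * M$1$1" using M21 by (simp_all add: a_def b_def)
    have v1: "v k$2$1 = b' * N$2$1" "v k$1$1 = a' + b' * N$1$1" using N21 by (simp_all add: a'_def b'_def)
    have "M$2$1 * (u k$2$2 - (a + b * M$2$2)) = 0" "M$2$1 * (u k$1$2 - b * M$1$2) = 0"
      using pu u1 by algebra+
    then have u2: "u k$2$2 = a + b * M$2$2" "u k$1$2 = b * M$1$2" using M21 by auto
    have "N$2$1 * (v k$2$2 - (a' + b' * N$2$2)) = 0" "N$2$1 * (v k$1$2 - b' * N$1$2) = 0"
      using pv v1 by algebra+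
    then have v2: "v k$2$2 = a' + b' * N$2$2" "v k$1$2 = b' * N$1$2" using N21 by auto
    have e1: "trace (u k) = trace (v k)" and e2: "det (u k) = det (v k)"
      and e3: "trace (M ** u k) = trace (N ** v k)"
      using ag i k unfolding agree_def M_def N_def by blast+
    have f1: "2 * (a - a') + trace M * (b - b') = 0"
      using e1 tr unfolding matrix_2 u1 u2 v1 v2 by algebra
    have "trace M * (a - a') + (trace M ^ 2 - 2 * det M) * (b - b') = 0"
      using e3 tr det unfolding matrix_2 u1 u2 v1 v2 by algebra
    then have f2: "trace M * (a - a') + 2 * det M * (b - b') = 0"
      using f1 by algebra
    have f3: "a^2 + trace M * a * b + det M * b^2 = a'^2 + trace M * a' * b' + det M * b'^2"
      using e2 tr det unfolding matrix_2 u1 u2 v1 v2 by algebra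
    \<comment> \<open>By \<open>f1\<close> and \<open>f2\<close> the difference of the coordinates
      lies in the radical of the polar form of the norm. Hence its norm is the difference of the
      norms, which is zero by \<open>f3\<close>. No division by 2 or by the discriminant occurs, so
      inseparable extensions are covered.\<close>
    have "(a - a')^2 + trace M * (a - a') * (b - b') + det M * (b - b')^2 = 0"
    proof -
      have "(a - a')^2 + trace M * (a - a') * (b - b') + det M * (b - b')^2
        = (a^2 + trace M * a * b + det M * b^2) - (a'^2 + trace M * a' * b' + det M * b'^2)
          - a' * (2 * (a - a') + trace M * (b - b')) - b' * (trace M * (a - a') + 2 * det M * (b - b'))"
        by (simp add: power2_eq_square algebra_simps)
      then show ?thesis unfolding f1 f2 f3 by simp
    qed
    from norm[OF this] have ab: "a = a'" "b = b'" by simp_all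
    show ?thesis using Mg unfolding matrix_2 u1 u2 v1 v2 ab by algebra
  qed
  moreover have "det g \<noteq> 0" using M21 N21 by (simp add: det_2 g)
  ultimately show ?thesis using that by blast
qed

section \<open>Tuples generating M(2) and the case distinction\<close>

definition frame :: "'a::field^2^2 \<Rightarrow> 'a^2^2 \<Rightarrow> 'a^2^2 \<Rightarrow> nat \<Rightarrow> 'a^2^2" where
  "frame A B C p = (if p = 0 then mat 1 else if p = 1 then A else if p = 2 then B else C)"

lemma frame_simps [simp]:
  "frame A B C 0 = mat 1" "frame A B C 1 = A" "frame A B C (Suc 0) = A" "frame A B C 2 = B" "frame A B C 3 = C"
  by (simp_all add: frame_def)

lemma lessThan_4_cases:
  assumes "p \<in> {..<4::nat}"
  obtains "p = 0" | "p = 1" | "p = 2" | "p = 3"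
  using assms by fastforce

text \<open>After \<open>agreeI\<close> only increasing triples remain, so the only word longer than
  three letters is the square of u_i u_j, whose trace comes from its trace and determinant.\<close>

lemma agree_frame_product:
  fixes u v :: "'a::field tup"
  assumes ag: "agree I u v" and ij: "i \<in> I" "j \<in> I"
  shows "agree {..<4} (frame (u i) (u j) (u i ** u j)) (frame (v i) (v j) (v i ** v j))"
proof -
  have a: "trace (u i) = trace (v i)" "det (u i) = det (v i)" "trace (u j) = trace (v j)" "det (u j) = det (v j)"
    "trace (u i ** u j) = trace (v i ** v j)"
    "trace (u i ** u i ** u j) = trace (v i ** v i ** v j)"
    "trace (u j ** u i ** u j) = trace (v j ** v i ** v j)"
    using ag ij unfolding agree_def by auto
  have b: "trace (u i ** u j ** u i ** u j) = trace (v i ** v j ** v i ** v j)"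
    using trace_square_2[of "u i ** u j"] trace_square_2[of "v i ** v j"] a
    by (simp add: det_mul matrix_mul_assoc)
  show ?thesis
    by (rule agreeI; elim lessThan_4_cases) (simp_all add: a b det_mul matrix_mul_assoc)
qed

lemma conj_of_frame:
  fixes u v :: "'a::field tup"
  assumes ag: "agree I u v" and ij: "i \<in> I" "j \<in> I"
    and T: "triple_form (u i) (u j) C \<noteq> 0"
    and fr: "agree {..<4} (frame (u i) (u j) C) (frame (v i) (v j) D)"
    and CD: "\<And>k. k \<in> I \<Longrightarrow> trace (u k ** C) = trace (v k ** D)"
  shows "\<exists>g. det g \<noteq> 0 \<and> (\<forall>k\<in>I. v k ** g = g ** u k)"
proof -
  obtain g where g: "det g \<noteq> 0"
    "\<And>X Y. (\<And>p. p < 4 \<Longrightarrow> trace (X ** frame (u i) (u j) C p) = trace (Y ** frame (v i) (v j) D p)) \<Longrightarrow> Y ** g = g ** X"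
    using conj_of_agree[OF _ _ _ fr] T by auto
  have "v k ** g = g ** u k" if k: "k \<in> I" for k
  proof (rule g(2))
    fix p :: nat assume "p < 4"
    then have "p \<in> {..<4}" by simp
    then show "trace (u k ** frame (u i) (u j) C p) = trace (v k ** frame (v i) (v j) D p)"
      using CD[OF k] k ag ij by (elim lessThan_4_cases) (auto simp: agree_def)
  qed
  with g(1) show ?thesis by blast
qed

lemma conj_of_irreducible:
  fixes u v :: "'a::field tup"
  assumes ag: "agree I u v" and ij: "i \<in> I" "j \<in> I"
    and T: "triple_form (u i) (u j) (u i ** u j) \<noteq> 0 \<or> (\<exists>k\<in>I. triple_form (u i) (u j) (u k) \<noteq> 0)"
  shows "\<exists>g. det g \<noteq> 0 \<and> (\<forall>k\<in>I. v k ** g = g ** u k)"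
  using T
proof (elim disjE bexE)
  assume T: "triple_form (u i) (u j) (u i ** u j) \<noteq> 0"
  show ?thesis
    by (rule conj_of_frame[OF ag ij T agree_frame_product[OF ag ij]])
      (use ag ij in \<open>auto simp: agree_def matrix_mul_assoc\<close>)
next
  fix k assume k: "k \<in> I" and T: "triple_form (u i) (u j) (u k) \<noteq> 0"
  have "agree {..<4} (frame (u i) (u j) (u k)) (frame (v i) (v j) (v k))"
    by (rule agreeI; elim lessThan_4_cases) (use ag ij k in \<open>simp_all add: agree_def\<close>)
  from conj_of_frame[OF ag ij T this] show ?thesis
    using ag k unfolding agree_def by blast
qed

lemma agree_sym: "agree I u v \<Longrightarrow> agree I v u"
  unfolding agree_def by simp

text \<open>Conjugation occurs in both directions because either tuple may be the one found to
  generate M(2).\<close>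

lemma agree_cases:
  fixes u v :: "'a::field tup"
  assumes ag: "agree I u v"
  obtains g where "det g \<noteq> 0" "\<And>k. k \<in> I \<Longrightarrow> u k ** g = g ** v k"
    | g where "det g \<noteq> 0" "\<And>k. k \<in> I \<Longrightarrow> v k ** g = g ** u k"
    | "common_eigenvector I u" "common_eigenvector I v"
proof -
  define irr where "irr w \<longleftrightarrow> (\<exists>i\<in>I. \<exists>j\<in>I. triple_form (w i) (w j) (w i ** w j) \<noteq> 0 \<or> (\<exists>k\<in>I. triple_form (w i) (w j) (w k) \<noteq> 0))"
    for w :: "'a tup"
  have comm: "w i ** w j = w j ** w i" if "\<not> irr w" "\<not> common_eigenvector I w" "i \<in> I" "j \<in> I" for i j w
    using that common_eigenvector_of_noncommuting[of "w i" "w j" I w] unfolding irr_def by blast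
  \<comment> \<open>Otherwise \<open>v\<close> commutes and some v_i has no eigenvector, whereas u_i
    has one and the same characteristic polynomial.\<close>
  have root: "common_eigenvector I v" if t: "\<not> irr v" "\<not> irr u" "common_eigenvector I u" "agree I u v" for u v :: "'a tup"
  proof (rule ccontr)
    assume n: "\<not> common_eigenvector I v"
    obtain i where i: "i \<in> I" "\<And>x y. eigform (v i) x y = 0 \<Longrightarrow> x = 0 \<and> y = 0"
      using common_eigenvector_of_commuting[OF comm[OF t(1) n] n] by blast
    moreover obtain x y where "x \<noteq> 0 \<or> y \<noteq> 0" "eigform (u i) x y = 0"
      using t(3) i(1) unfolding common_eigenvector_def by blast
    moreover have "trace (u i) = trace (v i)" "det (u i) = det (v i)"
      using t(4) i(1) unfolding agree_def by auto
    ultimately show False using eigform_zero_iff_root by metis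
  qed
  show ?thesis
  proof (cases "irr u")
    case True
    then show ?thesis using conj_of_irreducible[OF ag] that(2) unfolding irr_def by metis
  next
    case nu: False
    show ?thesis
    proof (cases "irr v")
      case True
      then show ?thesis using conj_of_irreducible[OF agree_sym[OF ag]] that(1) unfolding irr_def by metis
    next
      case nv: False
      show ?thesis
      proof (cases "common_eigenvector I u")
        case True
        then show ?thesis using root[OF nv nu True ag] that(3) by blast
      next
        case nt: False
        then have nt': "\<not> common_eigenvector I v" using root[OF nu nv _ agree_sym[OF ag]] by blast
        obtain i where i: "i \<in> I" "\<And>x y. eigform (u i) x y = 0 \<Longrightarrow> x = 0 \<and> y = 0"
          using common_eigenvector_of_commuting[OF comm[OF nu nt] nt] by blast
        show ?thesis
          using conj_of_commuting[OF ag i(1) comm[OF nu nt i(1)] comm[OF nv nt' i(1)] i(2)] that(1) by metis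
      qed
    qed
  qed
qed

section \<open>Values of invariants\<close>

lemma det_nonzero_inverse:
  fixes g :: "'a::field^2^2"
  assumes "det g \<noteq> 0"
  shows "invertible g" "matrix_inv g ** g = mat 1" "g ** matrix_inv g = mat 1"
proof -
  show i: "invertible g" using assms by (simp add: invertible_det_nz)
  have "\<exists>B. g ** B = mat 1 \<and> B ** g = mat 1" using i by (simp add: invertible_def)
  then have "g ** matrix_inv g = mat 1 \<and> matrix_inv g ** g = mat 1"
    unfolding matrix_inv_def by (rule someI_ex)
  then show "matrix_inv g ** g = mat 1" "g ** matrix_inv g = mat 1" by auto
qed

lemma invariant_conj:
  fixes u v :: "'a::field tup"
  assumes f: "f \<in> invariants d" and uv: "u \<in> H d" "v \<in> H d" and g: "det g \<noteq> 0"
    and c: "\<And>k. k \<in> {1..d} \<Longrightarrow> u k ** g = g ** v k"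
  shows "f u = f v"
proof -
  have "matrix_inv g ** u k ** g = v k" for k
  proof (cases "k \<in> {1..d}")
    case True
    have "matrix_inv g ** u k ** g = (matrix_inv g ** g) ** v k"
      using c[OF True] by (metis matrix_mul_assoc)
    then show ?thesis using det_nonzero_inverse[OF g] by simp
  next
    case False then show ?thesis using uv by (simp add: H_def matrix_eq_2 matrix_mult_nth_2)
  qed
  then have "f v = f (\<lambda>k. matrix_inv g ** u k ** g)" by simp
  also have "\<dots> = f u"
    using f uv det_nonzero_inverse[OF g] unfolding invariants_def by blast
  finally show ?thesis ..
qed

lemma poly_fun_on_line:
  assumes "f \<in> poly_fun d"
  shows "\<exists>p. \<forall>t. f (\<lambda>k. (\<chi> i j. a k $ i $ j + t * b k $ i $ j)) = poly p t"
  using assms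
proof induction
  case (const c)
  then show ?case by (intro exI[of _ "[:c:]"]) simp
next
  case (coord k i j)
  then show ?case by (intro exI[of _ "[:a k $ i $ j, b k $ i $ j:]"]) simp
next
  case (add f g)
  then show ?case by (metis poly_add)
next
  case (mult f g)
  then show ?case by (metis poly_mult)
qed

text \<open>Conjugation by diag(1, t) multiplies the upper right entries by t. The value of
  \<open>f\<close> is thus a polynomial in t that is constant for nonzero t, and t = 0 follows
  because the field is infinite.\<close>

lemma invariant_degenerate:
  fixes u :: "'a::field tup"
  assumes inf: "infinite (UNIV :: 'a set)" and f: "f \<in> invariants d" and u: "u \<in> H d"
    and up: "\<And>k. k \<in> {1..d} \<Longrightarrow> u k $ 2 $ 1 = 0"
  shows "f u = f (\<lambda>k. \<chi> i j. if i = j then u k $ i $ j else 0)"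
proof -
  have up: "u k $ 2 $ 1 = 0" for k using up u by (cases "k \<in> {1..d}") (auto simp: H_def)
  define w where "w t = (\<lambda>k. \<chi> i j. (if i = j then u k $ i $ j else 0) + t * (if i = j then 0 else u k $ i $ j))" for t
  obtain p where p: "\<And>t. f (w t) = poly p t"
    using poly_fun_on_line[of f d "\<lambda>k. \<chi> i j. if i = j then u k $ i $ j else 0" "\<lambda>k. \<chi> i j. if i = j then 0 else u k $ i $ j"]
      f unfolding w_def invariants_def by auto
  have wH: "w t \<in> H d" for t
    using u unfolding H_def w_def by (auto simp: matrix_eq_2)
  have "poly p t = f u" if t: "t \<noteq> 0" for t
  proof -
    define g :: "'a^2^2" where "g = (\<chi> i j. if i = j then (if i = 1 then 1 else t) else 0)"
    have "f u = f (w t)"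
      by (rule invariant_conj[OF f u wH, of g])
        (use t in \<open>simp_all add: g_def w_def matrix_2 up\<close>)
    then show ?thesis using p by simp
  qed
  then have "- {0} \<subseteq> {t. poly (p - [:f u:]) t = 0}" by auto
  moreover have "infinite (- {0::'a})" using inf by (simp add: Compl_eq_Diff_UNIV)
  ultimately have "infinite {t. poly (p - [:f u:]) t = 0}" using finite_subset by blast
  then have "p - [:f u:] = 0" using poly_roots_finite by blast
  then have "poly p 0 = f u" by simp
  then show ?thesis using p[of 0] by (simp add: w_def)
qed

section \<open>Reduction to diagonal tuples\<close>

definition diag_tuple :: "nat \<Rightarrow> (nat \<Rightarrow> 'a::field) \<Rightarrow> (nat \<Rightarrow> 'a) \<Rightarrow> 'a tup" where
  "diag_tuple d a b k = (\<chi> i j. if k \<in> {1..d} \<and> i = j then if i = 1 then a k else b k else 0)"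

lemma diag_tuple_in_H: "diag_tuple d a b \<in> H d"
  by (auto simp: H_def diag_tuple_def vec_eq_iff)

lemma trace_conj:
  fixes g :: "'a::field^2^2"
  assumes "det g \<noteq> 0"
  shows "trace (matrix_inv g ** X ** g) = trace X"
proof -
  have "trace (matrix_inv g ** X ** g) = trace (X ** (g ** matrix_inv g))"
    using trace_mult_cyclic_2[of "matrix_inv g" X g] by (simp only: matrix_mul_assoc)
  then show ?thesis by (simp add: det_nonzero_inverse[OF assms])
qed

lemma det_conj:
  fixes g :: "'a::field^2^2"
  assumes "det g \<noteq> 0"
  shows "det (matrix_inv g ** X ** g) = det X"
proof -
  have "det (matrix_inv g) * det g = 1"
    using det_nonzero_inverse(2)[OF assms] by (metis det_I det_mul)
  then have "det (matrix_inv g) * det X * det g = det X" by algebra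
  then show ?thesis by (simp only: det_mul)
qed

lemma conj_mult:
  fixes g :: "'a::field^2^2"
  assumes "det g \<noteq> 0"
  shows "matrix_inv g ** A ** g ** (matrix_inv g ** B ** g) = matrix_inv g ** (A ** B) ** g"
proof -
  have "matrix_inv g ** A ** g ** (matrix_inv g ** B ** g) = matrix_inv g ** A ** (g ** matrix_inv g) ** B ** g"
    by (simp only: matrix_mul_assoc)
  then show ?thesis by (simp add: det_nonzero_inverse[OF assms] matrix_mul_assoc)
qed

text \<open>The eigenvector is completed to a basis, which makes the tuple upper triangular. Its
  strictly upper part affects neither the invariant nor the traces of words.\<close>

lemma invariant_common_eigenvector:
  fixes u :: "'a::field tup"
  assumes inf: "infinite (UNIV :: 'a set)" and f: "f \<in> invariants d" and u: "u \<in> H d"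
    and ev: "common_eigenvector {1..d} u"
  obtains a b where "f u = f (diag_tuple d a b)" "agree {1..d} u (diag_tuple d a b)"
proof -
  obtain x y where xy: "x \<noteq> 0 \<or> y \<noteq> 0" and e: "\<And>k. k \<in> {1..d} \<Longrightarrow> eigform (u k) x y = 0"
    using ev unfolding common_eigenvector_def by blast
  obtain z w where zw: "x * w - y * z \<noteq> 0"
  proof (cases "x = 0")
    case True then show ?thesis using that[of 0 1] xy by simp
  next
    case False then show ?thesis using that[of 1 0] by simp
  qed
  define g :: "'a^2^2" where "g = (\<chi> i j. if j = 1 then if i = 1 then x else y else if i = 1 then z else w)"
  have g: "g$1$1 = x" "g$2$1 = y" "g$1$2 = z" "g$2$2 = w" by (simp_all add: g_def)
  have dg: "det g \<noteq> 0" using zw by (simp add: det_2 g mult.commute)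
  define v where "v k = matrix_inv g ** u k ** g" for k
  have vg: "g ** v k = u k ** g" for k
    unfolding v_def by (metis det_nonzero_inverse(3)[OF dg] matrix_mul_assoc matrix_mul_lid)
  have vH: "v \<in> H d" using u unfolding H_def v_def by (simp add: matrix_eq_2 matrix_mult_nth_2)
  have up: "v k $ 2 $ 1 = 0" if "k \<in> {1..d}" for k
  proof -
    have "(x * w - y * z) * v k $ 2 $ 1 = 0"
      using vg[of k] e[OF that] unfolding eigform_def matrix_2 g by algebra
    then show ?thesis using zw by simp
  qed
  define a b where "a k = v k $ 1 $ 1" and "b k = v k $ 2 $ 2" for k
  have "f u = f v" using invariant_conj[OF f u vH dg] vg by simp
  also have "\<dots> = f (\<lambda>k. \<chi> i j. if i = j then v k $ i $ j else 0)"
    by (rule invariant_degenerate[OF inf f vH up])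
  also have "(\<lambda>k. \<chi> i j. if i = j then v k $ i $ j else 0) = diag_tuple d a b"
    using vH by (auto simp: fun_eq_iff diag_tuple_def a_def b_def matrix_eq_2 H_def)
  finally have "f u = f (diag_tuple d a b)" .
  moreover have "agree {1..d} u v"
  proof (rule agreeI)
    fix i j k
    show "trace (u i) = trace (v i)" "det (u i) = det (v i)"
      using dg by (simp_all add: v_def trace_conj det_conj)
    show "trace (u i ** u j) = trace (v i ** v j)" "trace (u i ** u j ** u k) = trace (v i ** v j ** v k)"
      by (simp_all only: v_def conj_mult[OF dg] trace_conj[OF dg])
  qed
  moreover have "agree {1..d} v (diag_tuple d a b)"
    by (rule agreeI) (simp_all add: diag_tuple_def a_def b_def matrix_2 up)
  ultimately show ?thesis using that unfolding agree_def by simp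
qed

text \<open>Trace and determinant fix each pair of diagonal entries up to order. The mixed traces
  force all orders to change together, which the permutation matrix realises.\<close>

lemma invariant_diag_tuple:
  fixes a b a' b' :: "nat \<Rightarrow> 'a::field"
  assumes f: "f \<in> invariants d" and ag: "agree {1..d} (diag_tuple d a b) (diag_tuple d a' b')"
  shows "f (diag_tuple d a b) = f (diag_tuple d a' b')"
proof -
  have s: "a k + b k = a' k + b' k" "a k * b k = a' k * b' k" if "k \<in> {1..d}" for k
    using ag that unfolding agree_def by (auto simp: diag_tuple_def matrix_2)
  have p: "a j * a k + b j * b k = a' j * a' k + b' j * b' k" if "j \<in> {1..d}" "k \<in> {1..d}" for j k
    using ag that unfolding agree_def by (auto simp: diag_tuple_def matrix_2)
  have c: "a' k = a k \<and> b' k = b k \<or> a' k = b k \<and> b' k = a k" if "k \<in> {1..d}" for k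
  proof -
    have "(a' k - a k) * (a' k - b k) = 0" using s[OF that] by algebra
    then have "a' k = a k \<or> a' k = b k" by simp
    then show ?thesis using s(1)[OF that] by (metis add.commute add_left_cancel)
  qed
  consider "\<And>k. k \<in> {1..d} \<Longrightarrow> a' k = a k \<and> b' k = b k"
    | i where "i \<in> {1..d}" "a i \<noteq> b i" "a' i = b i" "b' i = a i"
    using c by metis
  then show ?thesis
  proof cases
    case 1
    then have "diag_tuple d a b = diag_tuple d a' b'" by (auto simp: diag_tuple_def fun_eq_iff matrix_eq_2)
    then show ?thesis by simp
  next
    case (2 i)
    have sw: "a' k = b k \<and> b' k = a k" if k: "k \<in> {1..d}" for k
    proof (cases "a' k = a k \<and> b' k = b k")
      case True
      have "(a i - b i) * (a k - b k) = 0" using p[OF 2(1) k] True 2(3,4) by algebra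
      then show ?thesis using True 2(2) by simp
    next
      case False then show ?thesis using c[OF k] by blast
    qed
    define g :: "'a^2^2" where "g = (\<chi> i j. if i = j then 0 else 1)"
    show ?thesis
      by (rule invariant_conj[OF f diag_tuple_in_H diag_tuple_in_H, of g])
        (use sw in \<open>simp_all add: g_def matrix_2 diag_tuple_def\<close>)
  qed
qed

lemma invariant_agree:
  fixes u v :: "'a::field tup"
  assumes inf: "infinite (UNIV :: 'a set)" and f: "f \<in> invariants d"
    and u: "u \<in> H d" and v: "v \<in> H d" and ag: "agree {1..d} u v"
  shows "f u = f v"
  using ag
proof (cases rule: agree_cases)
  case (1 g) then show ?thesis by (rule invariant_conj[OF f u v])
next
  case (2 g) then show ?thesis by (rule invariant_conj[OF f v u, symmetric])
next
  case 3
  obtain a b where ab: "f u = f (diag_tuple d a b)" "agree {1..d} u (diag_tuple d a b)"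
    using invariant_common_eigenvector[OF inf f u 3(1)] by blast
  obtain a' b' where ab': "f v = f (diag_tuple d a' b')" "agree {1..d} v (diag_tuple d a' b')"
    using invariant_common_eigenvector[OF inf f v 3(2)] by blast
  have "agree {1..d} (diag_tuple d a b) (diag_tuple d a' b')"
    using ag ab(2) ab'(2) unfolding agree_def by simp
  then show ?thesis using invariant_diag_tuple[OF f, of a b a' b'] ab(1) ab'(1) by simp
qed

section \<open>Minimality\<close>

lemma poly_fun_minus:
  assumes "f \<in> poly_fun d" "g \<in> poly_fun d"
  shows "(\<lambda>u. f u - g u) \<in> poly_fun d"
  using poly_fun.add[OF assms(1) poly_fun.mult[OF poly_fun.const[of "- 1"] assms(2)]] by simp

lemma S_cases:
  assumes "s \<in> S d"
  obtains i where "i \<in> {1..d}" "s = (\<lambda>u. trace (u i))"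
    | i where "i \<in> {1..d}" "s = (\<lambda>u. det (u i))"
    | i j where "1 \<le> i" "i < j" "j \<le> d" "s = (\<lambda>u. trace (u i ** u j))"
    | i j k where "1 \<le> i" "i < j" "j < k" "k \<le> d" "s = (\<lambda>u. trace (u i ** u j ** u k))"
  using assms unfolding S_def by auto

lemma S_subset_invariants: "S d \<subseteq> (invariants d :: ('a::field tup \<Rightarrow> 'a) set)"
proof
  fix s :: "'a tup \<Rightarrow> 'a" assume s: "s \<in> S d"
  note pf = poly_fun.intros poly_fun_minus
  have "s \<in> poly_fun d"
    using s by (cases rule: S_cases; simp only: matrix_2)
      (intro pf; simp)+
  moreover have "s (\<lambda>k. matrix_inv g ** u k ** g) = s u" if g: "invertible g" for g u
  proof -
    have dg: "det g \<noteq> 0" using g by (simp add: invertible_det_nz)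
    show ?thesis
      using s by (cases rule: S_cases) (simp_all only: conj_mult[OF dg] trace_conj[OF dg] det_conj[OF dg])
  qed
  ultimately show "s \<in> invariants d" unfolding invariants_def by blast
qed

lemma agree_of_S:
  assumes "\<And>s. s \<in> S d \<Longrightarrow> s u = s v"
  shows "agree {1..d} u v"
proof (rule agreeI)
  fix i assume "i \<in> {1..d}"
  then have "(\<lambda>u. trace (u i)) \<in> S d" "(\<lambda>u. det (u i)) \<in> S d"
    unfolding S_def by blast+
  from this[THEN assms] show "trace (u i) = trace (v i)" "det (u i) = det (v i)" by auto
next
  fix i j assume "i \<in> {1..d}" "j \<in> {1..d}" "i < j"
  then have "(\<lambda>u. trace (u i ** u j)) \<in> S d" unfolding S_def by auto
  from this[THEN assms] show "trace (u i ** u j) = trace (v i ** v j)" .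
next
  fix i j k assume "i \<in> {1..d}" "j \<in> {1..d}" "k \<in> {1..d}" "i < j" "j < k"
  then have "(\<lambda>u. trace (u i ** u j ** u k)) \<in> S d" unfolding S_def by auto
  from this[THEN assms] show "trace (u i ** u j ** u k) = trace (v i ** v j ** v k)" .
qed

section \<open>Pairs of points told apart by a single element\<close>

definition mat2 :: "'a::field \<Rightarrow> 'a \<Rightarrow> 'a \<Rightarrow> 'a \<Rightarrow> 'a^2^2" where
  "mat2 a b c e = (\<chi> i j. if i = 1 then if j = 1 then a else b else if j = 1 then c else e)"

lemma mat2_nth [simp]:
  "mat2 a b c e $ 1 $ 1 = a" "mat2 a b c e $ 1 $ 2 = b" "mat2 a b c e $ 2 $ 1 = c" "mat2 a b c e $ 2 $ 2 = e"
  by (simp_all add: mat2_def)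

text \<open>In the first three cases every other element of \<open>S d\<close> vanishes at both
  points; in the last, the others merely agree.\<close>

lemma S_element_essential:
  assumes "s \<in> S d"
  obtains u v :: "'a::field tup" where "u \<in> H d" "v \<in> H d" "s u \<noteq> s v"
    "\<And>t. t \<in> S d \<Longrightarrow> t \<noteq> s \<Longrightarrow> t u = t v"
  using assms
proof (cases rule: S_cases)
  case (1 i)
  define u v :: "'a tup" where "u = (\<lambda>k. if k = i then mat2 1 0 0 0 else 0)" and "v = (\<lambda>k. 0)"
  show ?thesis
  proof (rule that)
    show "u \<in> H d" "v \<in> H d" "s u \<noteq> s v"
      using 1 by (auto simp: u_def v_def H_def matrix_2)
    fix t :: "'a tup \<Rightarrow> 'a" assume "t \<in> S d" "t \<noteq> s"
    then show "t u = t v"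
      by (cases rule: S_cases) (use 1 in \<open>auto simp: u_def v_def matrix_2\<close>)
  qed
next
  case (2 i)
  define u v :: "'a tup" where "u = (\<lambda>k. if k = i then mat2 0 1 1 0 else 0)" and "v = (\<lambda>k. 0)"
  show ?thesis
  proof (rule that)
    show "u \<in> H d" "v \<in> H d" "s u \<noteq> s v"
      using 2 by (auto simp: u_def v_def H_def matrix_2)
    fix t :: "'a tup \<Rightarrow> 'a" assume "t \<in> S d" "t \<noteq> s"
    then show "t u = t v"
      by (cases rule: S_cases) (use 2 in \<open>auto simp: u_def v_def matrix_2\<close>)
  qed
next
  case (3 i j)
  define u v :: "'a tup" where "u = (\<lambda>k. if k = i then mat2 0 1 0 0 else if k = j then mat2 0 0 1 0 else 0)"
    and "v = (\<lambda>k. if k = i then mat2 0 1 0 0 else 0)"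
  show ?thesis
  proof (rule that)
    show "u \<in> H d" "v \<in> H d" "s u \<noteq> s v"
      using 3 by (auto simp: u_def v_def H_def matrix_2)
    fix t :: "'a tup \<Rightarrow> 'a" assume "t \<in> S d" "t \<noteq> s"
    then show "t u = t v"
      by (cases rule: S_cases) (use 3 in \<open>auto simp: u_def v_def matrix_2\<close>)
  qed
next
  case (4 i j k)
  define u :: "'a tup" where "u = (\<lambda>l. if l = i then mat2 0 1 0 0 else if l = j then mat2 0 0 1 0
    else if l = k then mat2 1 0 0 0 else 0)"
  \<comment> \<open>Transposition reverses words, so it preserves determinants and traces of at most
    two letters, but sends tr(E12 E21 E11) = 1 to tr(E21 E12 E11) = 0.\<close>
  define v where "v l = transpose (u l)" for l
  show ?thesis
  proof (rule that)
    show "u \<in> H d" "v \<in> H d" "s u \<noteq> s v"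
      using 4 by (auto simp: u_def v_def H_def matrix_2 transpose_def)
    fix t :: "'a tup \<Rightarrow> 'a" assume "t \<in> S d" "t \<noteq> s"
    then show "t u = t v"
    proof (cases rule: S_cases)
      case (4 i' j' k')
      then have "\<not> (i' = i \<and> j' = j \<and> k' = k)" using \<open>s = _\<close> \<open>t \<noteq> s\<close> by blast
      \<comment> \<open>Both triples are strictly increasing, so they would coincide if one were
        contained in the other.\<close>
      then have "i' \<notin> {i, j, k} \<or> j' \<notin> {i, j, k} \<or> k' \<notin> {i, j, k}"
        using 4 \<open>i < j\<close> \<open>j < k\<close> by auto
      then have "u i' = 0 \<or> u j' = 0 \<or> u k' = 0" by (auto simp: u_def)
      then show ?thesis unfolding 4 by (auto simp: v_def matrix_2 transpose_def)
    qed (auto simp: v_def matrix_2 transpose_def algebra_simps)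
  qed
qed

text \<open>In the main theorem, the second occurrence of S lives over a field of its own, which is not
  assumed to be infinite.\<close>
lemma S_minimal:
  assumes T: "T \<subset> S d"
  shows "\<not> separating d T"
proof
  assume sep: "separating d T"
  obtain s where s: "s \<in> S d" "s \<notin> T" using T by blast
  obtain u v where uv: "u \<in> H d" "v \<in> H d" "s u \<noteq> s v" "\<And>t. t \<in> S d \<Longrightarrow> t \<noteq> s \<Longrightarrow> t u = t v"
    using S_element_essential[OF s(1)] by blast
  have "separated_by d (invariants d) u v"
    using s(1) uv(3) S_subset_invariants unfolding separated_by_def by blast
  then have "separated_by d T u v"
    using sep uv(1,2) unfolding separating_def by blast
  then obtain t where "t \<in> T" "t u \<noteq> t v" unfolding separated_by_def by blast
  then show False using uv(4) T s(2) by blast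
qed

theorem theorem1:
  fixes d :: nat
  assumes "infinite (UNIV :: ('a::field) set)"
    and "d \<ge> 1"
  shows "separating d (S d :: ('a tup \<Rightarrow> 'a) set) \<and>
         (\<forall>T. T \<subset> S d \<longrightarrow> \<not> separating d T)"
proof (intro conjI allI impI)
  show "separating d (S d :: ('a tup \<Rightarrow> 'a) set)"
    unfolding separating_def separated_by_def
    using S_subset_invariants invariant_agree[OF assms(1)] agree_of_S by metis
qed (rule S_minimal)

end
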